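(* Let $n\ge 2$, and in $S_{n+1}$ let $a_i=(1,2)(i+1,i+2)$ for $1\le i\le n-1$. For $1\le j\le n-1$ let $$R^A_j=\{1,\ a_j,\ a_ja_{j-1},\ \dots,\ a_j\cdots a_2,\ a_j\cdots a_2a_1,\ a_j\cdots a_2a_1^{-1}\}\subseteq A_{n+1}.$$ Then for every $v\in A_{n+1}$ there exist unique elements $v_j\in R^A_j$ ($1\le j\le n-1$) such that $v=v_1v_2\cdots v_{n-1}$.
   Context: Products of permutations are compositions of functions, $(\sigma\tau)(k)=\sigma(\tau(k))$. For $j=1$ the set $R^A_1$ is $\{1,a_1,a_1^{-1}\}$. *)

theory Defs
  imports "HOL-Algebra.Sym_Groups" "HOL-Library.FuncSet"
begin

text \<open>A composition \<open>f\<^sub>1 \<circ> f\<^sub>2 \<circ> \<dots>\<close> of a list, read left to right; the empty product is \<^term>\<open>id\<close>.\<close>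

definition comp_list :: "('a \<Rightarrow> 'a) list \<Rightarrow> 'a \<Rightarrow> 'a" where
  "comp_list fs = foldr (\<circ>) fs id"

definition a_gen :: "nat \<Rightarrow> nat \<Rightarrow> nat" where
  "a_gen i = transpose 1 2 \<circ> transpose (i + 1) (i + 2)"

text \<open>The product \<open>a\<^sub>j a\<^bsub>j-1\<^esub> \<cdots> a\<^sub>k\<close> with descending indices, which is \<^term>\<open>id\<close> for \<open>k = j + 1\<close>.\<close>

definition a_desc :: "nat \<Rightarrow> nat \<Rightarrow> nat \<Rightarrow> nat" where
  "a_desc j k = comp_list (map a_gen (rev [k..<j + 1]))"

definition RA :: "nat \<Rightarrow> (nat \<Rightarrow> nat) set" where
  "RA j = {id} \<union> {a_desc j k | k. 1 \<le> k \<and> k \<le> j} \<union> {a_desc j 2 \<circ> inv' (a_gen 1)}"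

end

theory Submission
  imports Defs
begin

text \<open>
  The inverse of \<open>a\<^sub>j \<cdots> a\<^sub>k\<close> carries the largest point \<open>j + 2\<close> down to \<open>k + 1\<close>, and the
  inverse of \<open>a\<^sub>j \<cdots> a\<^sub>2 a\<^sub>1\<^sup>-\<^sup>1\<close> carries it to \<open>1\<close>. So \<open>R\<^sup>A\<^sub>j\<close> has exactly one element sending a
  given \<open>x \<le> j + 2\<close> to \<open>j + 2\<close>, which makes it a transversal of the right cosets of
  \<open>A\<^bsub>j+1\<^esub>\<close> (the stabiliser of \<open>j + 2\<close>) in \<open>A\<^bsub>j+2\<^esub>\<close>. The factorisation follows by peeling
  off the last factor.
\<close>

lemma alt_group_comp:
  assumes "p \<in> carrier (alt_group n)" "q \<in> carrier (alt_group n)"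
  shows "p \<circ> q \<in> carrier (alt_group n)"
  using assms alt_group_carrier'[OF assms(1)] alt_group_carrier'[OF assms(2)]
  by (auto simp: alt_group_carrier evenperm_comp intro: permutes_compose)

lemma alt_group_id: "id \<in> carrier (alt_group n)"
  by (simp add: alt_group_carrier evenperm_id permutes_id)

lemma alt_group_mono:
  assumes "m \<le> n"
  shows "carrier (alt_group m) \<subseteq> carrier (alt_group n)"
  using assms permutes_subset[of _ "{1..m}" "{1..n}"] by (auto simp: alt_group_carrier)

text \<open>A permutation of \<open>{1..Suc n}\<close> fixing \<open>Suc n\<close> moves only points
  of \<open>{1..n}\<close>. Parity is a property of the function alone, so it survives the change of
  degree.\<close>

lemma alt_group_fixes_last:
  assumes "p \<in> carrier (alt_group (Suc n))" "p (Suc n) = Suc n"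
  shows "p \<in> carrier (alt_group n)"
proof -
  have "p permutes {1..n}"
  proof (rule permutes_superset[of p "{1..Suc n}"])
  qed (use assms in \<open>auto simp: alt_group_carrier le_Suc_eq\<close>)
  then show ?thesis using assms by (simp add: alt_group_carrier)
qed

text \<open>Start of the induction: with no factors at all, only \<open>id\<close> can be
  reached.\<close>

lemma alt_group_two: "carrier (alt_group 2) = {id}"
proof -
  have "p = id" if p: "p permutes {1..2::nat}" "evenperm p" for p
  proof -
    have "p permutes {1, 2}" using p(1) by (simp add: numeral_2_eq_2 atLeastAtMostSuc_conv insert_commute)
    then have "p = id \<or> p = transpose 1 2" by (simp add: permutes_doubleton_iff)
    then show ?thesis using p(2) by (auto simp: evenperm_swap)
  qed
  then show ?thesis using alt_group_id by (auto simp: alt_group_carrier)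
qed

lemma comp_list_Nil: "comp_list [] = id"
  by (simp only: comp_list_def foldr.simps id_apply)

lemma comp_list_Cons: "comp_list (f # fs) = f \<circ> comp_list fs"
  by (simp only: comp_list_def foldr.simps o_apply)

lemma comp_list_append: "comp_list (xs @ ys) = comp_list xs \<circ> comp_list ys"
  by (induction xs) (simp_all only: append.simps comp_list_Nil comp_list_Cons id_comp comp_assoc)

lemma comp_list_single: "comp_list [f] = f"
  by (simp only: comp_list_Cons comp_list_Nil comp_id)

lemma comp_list_in_alt_group:
  "(\<And>f. f \<in> set fs \<Longrightarrow> f \<in> carrier (alt_group n)) \<Longrightarrow> comp_list fs \<in> carrier (alt_group n)"
  by (induction fs) (simp_all add: comp_list_Nil comp_list_Cons alt_group_id alt_group_comp)

lemma a_gen_in_alt_group: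
  assumes "1 \<le> i" "i \<le> j"
  shows "a_gen i \<in> carrier (alt_group (j + 2))"
proof -
  have "a_gen i permutes {1..j + 2}"
    unfolding a_gen_def using assms by (intro permutes_compose permutes_swap_id) auto
  moreover have "evenperm (a_gen i)"
    unfolding a_gen_def by (subst evenperm_comp) (auto simp: permutation_swap_id evenperm_swap)
  ultimately show ?thesis by (simp add: alt_group_carrier)
qed

lemma a_desc_in_alt_group:
  assumes "1 \<le> k"
  shows "a_desc j k \<in> carrier (alt_group (j + 2))"
  unfolding a_desc_def using assms a_gen_in_alt_group
  by (intro comp_list_in_alt_group) auto

text \<open>Splits off the rightmost factor, the one that acts first on a point.\<close>

lemma a_desc_step: "k \<le> j \<Longrightarrow> a_desc j k = a_desc j (Suc k) \<circ> a_gen k"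
  unfolding a_desc_def
  by (simp add: upt_conv_Cons comp_list_append comp_list_single del: upt_Suc)

lemma a_desc_top: "a_desc j (Suc j) = id"
  by (simp add: a_desc_def comp_list_def)

lemma a_gen_apply: "1 \<le> k \<Longrightarrow> a_gen k (k + 1) = k + 2"
  by (auto simp: a_gen_def transpose_def)

text \<open>The factors act in the order \<open>a_gen k\<close>, ..., \<open>a_gen j\<close>, and
  each raises the point by one: k+1, k+2, ..., j+2.\<close>

lemma a_desc_apply:
  assumes "1 \<le> k" "k \<le> j + 1"
  shows "a_desc j k (k + 1) = j + 2"
  using assms(2,1)
\<comment> \<open>The induction descends from k = j+1, where the empty product fixes j+2.\<close>
proof (induction k rule: inc_induct)
  case base
  then show ?case by (simp add: a_desc_top)
next
  case (step k)
  then show ?case using a_gen_apply[of k] by (simp add: a_desc_step)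
qed

text \<open>Indexes the transversal by the point x that its element carries to j+2; x = j+2 gives
  the empty product.\<close>

definition RA_elt :: "nat \<Rightarrow> nat \<Rightarrow> nat \<Rightarrow> nat" where
  "RA_elt j x = (if x = 1 then a_desc j 2 \<circ> inv' (a_gen 1) else a_desc j (x - 1))"

lemma RA_eq_image: "RA j = RA_elt j ` {1..j + 2}"
proof -
  \<comment> \<open>The three pieces index the element with the inverse, the identity, and the
    products \<open>a_desc j k\<close> at x = k+1.\<close>
  have "{1..j + 2} = insert 1 (insert (j + 2) (Suc ` {1..j}))"
    by (auto simp: image_Suc_atLeastAtMost)
  then have "RA_elt j ` {1..j + 2} =
      insert (RA_elt j 1) (insert (RA_elt j (j + 2)) ((\<lambda>k. RA_elt j (Suc k)) ` {1..j}))"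
    by (simp only: image_insert image_image)
  also have "(\<lambda>k. RA_elt j (Suc k)) ` {1..j} = a_desc j ` {1..j}"
    by (intro image_cong) (auto simp: RA_elt_def)
  finally show ?thesis
    by (auto simp: RA_def RA_elt_def a_desc_top)
qed

lemma RA_elt_in_alt_group:
  assumes "1 \<le> j" "1 \<le> x"
  shows "RA_elt j x \<in> carrier (alt_group (j + 2))"
proof -
  have "a_gen 1 \<in> carrier (alt_group (j + 2))" using a_gen_in_alt_group assms(1) by simp
  then show ?thesis
    using assms(2) a_desc_in_alt_group[of _ j]
    by (simp add: RA_elt_def alt_group_comp alt_group_inv_closed)
qed

lemma RA_in_alt_group: "1 \<le> j \<Longrightarrow> RA j \<subseteq> carrier (alt_group (j + 2))"
  using RA_elt_in_alt_group by (auto simp: RA_eq_image)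

lemma RA_elt_apply:
  assumes "1 \<le> j" "x \<in> {1..j + 2}"
  shows "RA_elt j x x = j + 2"
proof (cases "x = 1")
  case True
  have "a_gen 1 permutes {1..1 + 2}"
    using a_gen_in_alt_group[of 1 1] by (simp add: alt_group_carrier)
  \<comment> \<open>\<open>a_gen 1\<close> is the 3-cycle 1 -> 2 -> 3 -> 1, so its inverse takes 1
    to 3, where \<open>a_desc j 2\<close> takes over.\<close>
  moreover have "a_gen 1 3 = 1" by (auto simp: a_gen_def transpose_def)
  ultimately have "inv' (a_gen 1) 1 = 3" by (simp add: permutes_inv_eq)
  then show ?thesis using True a_desc_apply[of 2 j] assms by (simp add: RA_elt_def)
next
  case False
  then show ?thesis using assms a_desc_apply[of "x - 1" j] by (auto simp: RA_elt_def)
qed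

text \<open>Some y indexes r, so r sends both x and y to j+2, and injectivity gives x = y.\<close>

lemma RA_unique:
  assumes "1 \<le> j" "r \<in> RA j" "r x = j + 2"
  shows "r = RA_elt j x"
proof -
  obtain y where y: "y \<in> {1..j + 2}" "r = RA_elt j y"
    using assms(2) by (auto simp: RA_eq_image)
  have "r \<in> carrier (alt_group (j + 2))" using RA_in_alt_group assms(1,2) by blast
  then have "inj r" by (auto simp: alt_group_carrier intro: permutes_inj)
  moreover have "r y = r x" using RA_elt_apply[OF assms(1) y(1)] y(2) assms(3) by simp
  ultimately show ?thesis using y(2) by (auto dest: injD)
qed

text \<open>Here m is the number of factors. Taking \<open>w\<close> extensional turns uniqueness of
  the factors into equality of functions.\<close>

lemma alt_group_factorization:
  "v \<in> carrier (alt_group (m + 2)) \<Longrightarrow>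
    \<exists>!w. w \<in> (\<Pi>\<^sub>E j\<in>{1..m}. RA j) \<and> v = comp_list (map w [1..<Suc m])"
proof (induction m arbitrary: v)
  case 0
  have "v = id" using 0 alt_group_two by (simp add: numeral_2_eq_2)
  then show ?case by (simp add: comp_list_def)
next
  case (Suc m)
  let ?k = "Suc m"
  let ?last = "?k + 2"
  have v: "v permutes {1..?last}" using Suc.prems by (simp add: alt_group_carrier)
  \<comment> \<open>The first m factors fix \<open>?last\<close>, so the last factor has to send
    this x to \<open>?last\<close>; that determines it as \<open>r\<close>.\<close>
  define x where "x = inv' v ?last"
  have x: "x \<in> {1..?last}"
    unfolding x_def using permutes_in_image[OF permutes_inv[OF v]] by simp
  have vx: "v x = ?last" using v by (simp add: x_def permutes_inverses)
  define r where "r = RA_elt ?k x"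
  have rG: "r \<in> carrier (alt_group ?last)" unfolding r_def using RA_elt_in_alt_group x by simp
  have r: "r permutes {1..?last}" using rG by (simp add: alt_group_carrier)
  have rRA: "r \<in> RA ?k" using x unfolding r_def RA_eq_image by (rule imageI)
  have rx: "r x = ?last" unfolding r_def using RA_elt_apply x by simp
  \<comment> \<open>Cancelling \<open>r\<close> leaves an even permutation fixing
    \<open>?last\<close>, to which the induction hypothesis applies.\<close>
  define u where "u = v \<circ> inv' r"
  have "inv' r ?last = x" using rx r by (simp add: permutes_inv_eq)
  then have "u ?last = ?last" using vx by (simp add: u_def)
  moreover have "u \<in> carrier (alt_group ?last)"
    unfolding u_def using Suc.prems rG by (intro alt_group_comp alt_group_inv_closed) auto
  ultimately have "u \<in> carrier (alt_group (m + 2))"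
    using alt_group_fixes_last[of u "m + 2"] by simp
  from Suc.IH[OF this] obtain w where
    w: "w \<in> (\<Pi>\<^sub>E j\<in>{1..m}. RA j)" "u = comp_list (map w [1..<?k])"
    and w_unique: "\<And>w'. w' \<in> (\<Pi>\<^sub>E j\<in>{1..m}. RA j) \<Longrightarrow> u = comp_list (map w' [1..<?k]) \<Longrightarrow> w' = w"
    by blast
  have ins: "{1..?k} = insert ?k {1..m}" by auto
  have split_last: "comp_list (map f [1..<Suc ?k]) = comp_list (map f [1..<?k]) \<circ> f ?k"
    for f :: "nat \<Rightarrow> nat \<Rightarrow> nat"
    by (simp add: comp_list_append comp_list_single)
  show ?case
  proof (rule ex1I[of _ "w(?k := r)"], intro conjI)
    show "w(?k := r) \<in> (\<Pi>\<^sub>E j\<in>{1..?k}. RA j)"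
      unfolding ins using w(1) rRA by (rule PiE_fun_upd[rotated])
    have "map (w(?k := r)) [1..<?k] = map w [1..<?k]" by simp
    then have "comp_list (map (w(?k := r)) [1..<Suc ?k]) = u \<circ> r"
      unfolding split_last w(2) by (simp only: fun_upd_same)
    also have "\<dots> = v"
      using permutes_inv_o(2)[OF r] by (simp add: u_def comp_assoc)
    finally show "v = comp_list (map (w(?k := r)) [1..<Suc ?k])" by simp
  next
    fix w'
    assume w': "w' \<in> (\<Pi>\<^sub>E j\<in>{1..?k}. RA j) \<and> v = comp_list (map w' [1..<Suc ?k])"
    define u' where "u' = comp_list (map w' [1..<?k])"
    have v_eq: "v = u' \<circ> w' ?k" using w' unfolding split_last u'_def by blast
    have w'k: "w' ?k \<in> RA ?k" using w' by auto
    \<comment> \<open>This makes \<open>u'\<close> fix \<open>?last\<close>; being injective, it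
      then forces \<open>w' ?k x = ?last\<close>, hence \<open>w' ?k = r\<close>.\<close>
    have "u' \<in> carrier (alt_group (m + 2))"
      unfolding u'_def
    proof (rule comp_list_in_alt_group)
      fix f assume "f \<in> set (map w' [1..<?k])"
      then obtain j where j: "1 \<le> j" "j \<le> m" "f = w' j" by auto
      then have "f \<in> RA j" using w' by auto
      then show "f \<in> carrier (alt_group (m + 2))"
        using RA_in_alt_group[OF j(1)] alt_group_mono[of "j + 2" "m + 2"] j(2) by auto
    qed
    then have u': "u' permutes {1..m + 2}" by (simp add: alt_group_carrier)
    then have "u' ?last = ?last" by (rule permutes_not_in) simp
    moreover have "u' (w' ?k x) = ?last" using vx v_eq by simp
    ultimately have "w' ?k x = ?last" using permutes_inj[OF u'] by (metis injD)
    then have w'r: "w' ?k = r" unfolding r_def using w'k by (intro RA_unique) auto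
    have "u = u'"
      using permutes_inv_o(1)[OF r] by (simp add: u_def v_eq w'r comp_assoc)
    \<comment> \<open>Restricting resets the value at \<open>?k\<close> to \<open>undefined\<close>,
      so that the uniqueness of \<open>w\<close> can be used.\<close>
    moreover have "comp_list (map (restrict w' {1..m}) [1..<?k]) = u'"
      unfolding u'_def by (intro arg_cong[of _ _ comp_list] map_cong) auto
    moreover have "restrict w' {1..m} \<in> (\<Pi>\<^sub>E j\<in>{1..m}. RA j)"
      using w' by auto
    ultimately have restr: "restrict w' {1..m} = w" using w_unique by simp
    show "w' = w(?k := r)"
    proof
      fix j
      show "w' j = (w(?k := r)) j"
      proof (cases "j = ?k")
        case False
        show ?thesis
        proof (cases "j \<in> {1..m}")
          case True
          then show ?thesis using False fun_cong[OF restr, of j] by simp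
        next
          case j: False
          \<comment> \<open>Outside \<open>{1..?k}\<close> both functions take the default value of
            extensional functions.\<close>
          have "w' j = undefined" using w' False j ins by (intro PiE_arb[of w' "{1..?k}" RA]) auto
          moreover have "w j = undefined" using w(1) j by (rule PiE_arb)
          ultimately show ?thesis using False by simp
        qed
      qed (simp add: w'r)
    qed
  qed
qed

theorem theorem3p4:
  fixes n :: nat
  assumes "n \<ge> 2"
  shows "(\<forall>j\<in>{1..n - 1}. RA j \<subseteq> carrier (alt_group (n + 1))) \<and>
    (\<forall>v\<in>carrier (alt_group (n + 1)).
      \<exists>!w. w \<in> (\<Pi>\<^sub>E j\<in>{1..n - 1}. RA j) \<and> v = comp_list (map w [1..<n]))"
proof (intro conjI ballI)
  fix j assume "j \<in> {1..n - 1}"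
  then have "1 \<le> j" "j + 2 \<le> n + 1" using assms by auto
  then show "RA j \<subseteq> carrier (alt_group (n + 1))"
    using RA_in_alt_group[of j] alt_group_mono[of "j + 2" "n + 1"] by blast
next
  fix v assume "v \<in> carrier (alt_group (n + 1))"
  then show "\<exists>!w. w \<in> (\<Pi>\<^sub>E j\<in>{1..n - 1}. RA j) \<and> v = comp_list (map w [1..<n])"
    \<comment> \<open>With m = n-1 the degree m+2 becomes n+1 and \<open>Suc m\<close> becomes
      n.\<close>
    using alt_group_factorization[of v "n - 1"] assms by simp
qed

end
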